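(* Let $h$ denote the meromorphic continuation to $\mathbb{C}$ of $h(s)=\sum_{n=1}^\infty H_n n^{-s}$ ($\operatorname{Re} s>1$). In a neighborhood of $s=0$, $$h(s) = \frac{1}{2s} + \frac{1}{2}(1+\gamma) + O(s),$$ where $\gamma$ is the Euler constant.
   Context: $H_n = 1+\frac12+\cdots+\frac1n$ are the harmonic numbers. The series for $h(s)$ converges for $\operatorname{Re} s>1$ and extends meromorphically to $\mathbb{C}$. The Euler constant is $\gamma=-\psi(1)$, where $\psi=\Gamma'/\Gamma$. *)

theory Defs
  imports "HOL-Complex_Analysis.Complex_Analysis" "HOL-Library.Landau_Symbols"
begin

definition harmonic_dirichlet_series :: "complex \<Rightarrow> complex" where
  "harmonic_dirichlet_series s = (\<Sum>n. harm (Suc n) * of_nat (Suc n) powr (-s))"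

text \<open>
  The meromorphic continuation of the series to the whole complex plane. The predicate
  \<open>nicely_meromorphic_on\<close> excludes removable singularities and fixes the value 0 at the
  poles, so that the continuation is unique as a total function.
\<close>
definition harmonic_zeta :: "complex \<Rightarrow> complex" where
  "harmonic_zeta = (THE f. f nicely_meromorphic_on UNIV \<and>
     (\<forall>s. Re s > 1 \<longrightarrow> f s = harmonic_dirichlet_series s))"

end

theory Submission
  imports Defs
begin

text \<open>
  Summing the Gamma integral termwise gives
  \<open>Gamma s * h s = \<integral>\<^sub>0\<^sup>\<infinity> t powr (s - 1) * F t dt\<close> with \<open>F t = - ln (1 - exp (-t)) / (1 - exp (-t))\<close>.
  The integral over \<open>t > 1\<close> is entire in \<open>s\<close>. The function \<open>q z = (1 - exp (-z)) / z\<close> has no zero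
  in \<open>\<bar>z\<bar> < 2 * pi\<close>, so \<open>q = exp \<circ> g\<close> there and \<open>t * F t = - ln t / q t - g t / q t\<close>. With the power
  series \<open>1 / q = \<Sum> a\<^sub>k z^k\<close> and \<open>g / q = \<Sum> b\<^sub>k z^k\<close>, whose radius of convergence exceeds 1, the
  integral over \<open>0 < t \<le> 1\<close> becomes
  \<open>\<Sum> (a\<^sub>k / (s + k - 1)^2 - b\<^sub>k / (s + k - 1))\<close>, which is meromorphic on the whole plane.
  Near \<open>s = 0\<close> only \<open>a\<^sub>1 = 1/2\<close> and \<open>b\<^sub>1 = - 1/2\<close> contribute a pole, and multiplying
  \<open>1 / (2 * s^2) + 1 / (2 * s) + O(1)\<close> by \<open>1 / Gamma s = s + \<gamma> * s^2 + O(s^3)\<close> gives the claim.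
\<close>

section \<open>Tools for Lebesgue integrals over sets, and the scaled Gamma integral\<close>

lemma set_integral_sums:
  fixes f :: "nat \<Rightarrow> 'a \<Rightarrow> 'b::{banach, second_countable_topology}"
  assumes A: "A \<in> sets M"
    and int: "\<And>n. set_integrable M A (f n)"
    and norm: "\<And>x. x \<in> A \<Longrightarrow> summable (\<lambda>n. norm (f n x))"
    and sum: "summable (\<lambda>n. LINT x:A|M. norm (f n x))"
    and sums: "\<And>x. x \<in> A \<Longrightarrow> (\<lambda>n. f n x) sums F x"
  shows "set_integrable M A F" "(\<lambda>n. LINT x:A|M. f n x) sums (LINT x:A|M. F x)"
proof -
  define g where "g = (\<lambda>n x. indicator A x *\<^sub>R f n x)"
  have g: "(\<Sum>n. g n x) = indicator A x *\<^sub>R F x" for x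
    using sums[of x] by (cases "x \<in> A") (auto simp: g_def sums_iff)
  have 1: "integrable M (g n)" for n
    using int[of n] by (simp add: set_integrable_def g_def)
  have 2: "AE x in M. summable (\<lambda>n. norm (g n x))"
    using norm by (intro AE_I2) (auto simp: g_def indicator_def)
  have 3: "summable (\<lambda>n. \<integral>x. norm (g n x) \<partial>M)"
    using sum by (simp add: g_def set_lebesgue_integral_def)
  show "set_integrable M A F"
    using integrable_suminf[OF 1 2 3] by (simp add: set_integrable_def g)
  show "(\<lambda>n. LINT x:A|M. f n x) sums (LINT x:A|M. F x)"
    using sums_integral[OF 1 2 3] unfolding g unfolding g_def set_lebesgue_integral_def .
qed

lemma powr_complex_measurable [measurable]:
  fixes f g :: "'a \<Rightarrow> complex"
  assumes [measurable]: "f \<in> borel_measurable M" "g \<in> borel_measurable M"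
  shows "(\<lambda>x. f x powr g x) \<in> borel_measurable M"
  unfolding powr_def by measurable

text \<open>A nonnegative gauge-integrable function is absolutely integrable. This turns values
  found by the fundamental theorem of calculus into Lebesgue integrals.\<close>

lemma nonneg_has_integral_imp_set_lborel:
  fixes f :: "real \<Rightarrow> real"
  assumes "(f has_integral I) A" "\<And>x. x \<in> A \<Longrightarrow> f x \<ge> 0"
    and [measurable]: "f \<in> borel_measurable borel" "A \<in> sets borel"
  shows "set_integrable lborel A f" "(LINT x:A|lborel. f x) = I"
proof -
  have "set_integrable lebesgue A f"
    using assms by (intro nonnegative_absolutely_integrable_1) auto
  then show *: "set_integrable lborel A f"
    unfolding set_integrable_def by (subst (asm) integrable_completion) measurable
  show "(LINT x:A|lborel. f x) = I"
    using set_borel_integral_eq_integral(2)[OF *] assms(1) by (simp add: integral_unique)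
qed

text \<open>Euler's integral is the case \<open>a = 1\<close>; the substitution of
  \<open>a * t\<close> for \<open>t\<close> produces the factor \<open>a powr (-s)\<close>.\<close>

lemma Gamma_set_integral:
  fixes s :: complex
  assumes s: "Re s > 0" and a: "a > 0"
  shows "set_integrable lborel {0<..} (\<lambda>t. of_real t powr (s - 1) / of_real (exp (a * t)))"
    "(LINT t:{0<..}|lborel. of_real t powr (s - 1) / of_real (exp (a * t))) = Gamma s * of_real a powr (-s)"
proof -
  have int: "set_integrable lborel {0<..} (\<lambda>t. complex_of_real t powr (s - 1) / of_real (exp (a * t)))"
    if "a > 0" for a
    using absolutely_integrable_Gamma_integral[OF s that] unfolding set_integrable_def
    by (subst (asm) integrable_completion) measurable
  show "set_integrable lborel {0<..} (\<lambda>t. complex_of_real t powr (s - 1) / of_real (exp (a * t)))"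
    by (rule int) fact
  define f where "f = (\<lambda>t. indicator {0<..} t *\<^sub>R (complex_of_real t powr (s - 1) / of_real (exp t)))"
  have "Gamma s = (LINT t:{0<..}|lborel. complex_of_real t powr (s - 1) / of_real (exp t))"
    using set_borel_integral_eq_integral(2)[OF int[of 1]] Gamma_integral_complex'[OF s]
    by (simp add: integral_unique)
  also have "\<dots> = integral\<^sup>L lborel f"
    by (simp add: set_lebesgue_integral_def f_def)
  also have "\<dots> = \<bar>a\<bar> *\<^sub>R (\<integral>t. f (0 + a * t) \<partial>lborel)"
    using a by (intro lborel_integral_real_affine) auto
  also have "(\<lambda>t. f (0 + a * t)) = (\<lambda>t. of_real a powr (s - 1) *
     (indicator {0<..} t *\<^sub>R (complex_of_real t powr (s - 1) / of_real (exp (a * t)))))"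
    using a by (auto simp: fun_eq_iff f_def indicator_def zero_less_mult_iff powr_times_real)
  also have "\<bar>a\<bar> *\<^sub>R (\<integral>t. (of_real a powr (s - 1) *
     (indicator {0<..} t *\<^sub>R (complex_of_real t powr (s - 1) / of_real (exp (a * t))))) \<partial>lborel) =
     of_real a powr s * (LINT t:{0<..}|lborel. complex_of_real t powr (s - 1) / of_real (exp (a * t)))"
    using a by (subst integral_mult_right_zero)
       (simp add: set_lebesgue_integral_def scaleR_conv_of_real powr_diff)
  finally show "(LINT t:{0<..}|lborel. complex_of_real t powr (s - 1) / of_real (exp (a * t))) =
      Gamma s * of_real a powr (-s)"
    using a by (simp add: powr_minus field_simps)
qed

section \<open>The generating function of the harmonic numbers and its Mellin transform\<close>

text \<open>Cauchy product of the series of \<open>- ln (1 - x)\<close> with the geometric series: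
  the partial sums of the coefficients 1/n are the harmonic numbers.\<close>

lemma sums_harm_power:
  fixes x :: real
  assumes "0 \<le> x" "x < 1"
  shows "(\<lambda>n. harm (Suc n) * x ^ Suc n) sums (- ln (1 - x) / (1 - x))"
proof -
  have "(\<lambda>n. - ((-(-x)) ^ n) / of_nat n) sums ln (1 + (-x))"
    using assms by (intro ln_series') auto
  then have "(\<lambda>n. - (- (x ^ n) / of_nat n)) sums (- ln (1 - x))"
    by (intro sums_minus) simp
  then have ln: "(\<lambda>n. x ^ Suc n / of_nat (Suc n)) sums (- ln (1 - x))"
    by (subst sums_Suc_iff) simp
  have geo: "(\<lambda>n. x ^ n) sums (1 / (1 - x))"
    using assms by (intro geometric_sums) auto
  have "(\<lambda>k. \<Sum>i\<le>k. (x ^ Suc i / of_nat (Suc i)) * x ^ (k - i)) sums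
      ((\<Sum>n. x ^ Suc n / of_nat (Suc n)) * (\<Sum>n. x ^ n))"
    using ln geo assms by (intro Cauchy_product_sums) (auto simp: sums_iff simp del: of_nat_Suc power_Suc)
  also have "(\<lambda>k. \<Sum>i\<le>k. (x ^ Suc i / of_nat (Suc i)) * x ^ (k - i)) = (\<lambda>k. harm (Suc k) * x ^ Suc k)"
  proof
    fix k
    have "(\<Sum>i\<le>k. (x ^ Suc i / of_nat (Suc i)) * x ^ (k - i)) = (\<Sum>i\<le>k. inverse (of_nat (Suc i)) * x ^ Suc k)"
      by (intro sum.cong refl) (auto simp: divide_inverse power_add [symmetric] simp flip: power_Suc)
    then show "(\<Sum>i\<le>k. (x ^ Suc i / of_nat (Suc i)) * x ^ (k - i)) = harm (Suc k) * x ^ Suc k"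
      by (simp only: harm_altdef lessThan_Suc_atMost sum_distrib_right)
  qed
  finally show ?thesis
    using ln geo by (simp add: sums_iff)
qed

lemma summable_harm_powr:
  fixes x :: real
  assumes "x > 1"
  shows "summable (\<lambda>n. harm (Suc n) * real (Suc n) powr (-x))"
proof -
  \<comment> \<open>Harmonic numbers grow like a logarithm, hence more slowly than any power
    \<open>n powr e\<close>. This \<open>e\<close> still leaves the exponent
    \<open>e - x = - (x + 1) / 2\<close> below -1.\<close>
  define e where "e = (x - 1) / 2"
  have e: "e > 0" using assms by (simp add: e_def)
  have "summable (\<lambda>n. (1 + 1 / e) * real (Suc n) powr (e - x))"
    using assms by (intro summable_mult) (subst summable_Suc_iff, auto simp: summable_real_powr_iff e_def field_simps)
  then show ?thesis
  proof (rule summable_comparison_test')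
    fix n :: nat
    have "harm (Suc n) \<le> 1 + ln (real (Suc n))"
      using euler_mascheroni_sequence_decreasing[of 1 "Suc n"] by (simp add: harm_expand)
    also have "\<dots> \<le> real (Suc n) powr e + real (Suc n) powr e / e"
      using ln_powr_bound[of "real (Suc n)" e] e by (intro add_mono) (auto intro: ge_one_powr_ge_zero)
    finally have "harm (Suc n) \<le> (1 + 1 / e) * real (Suc n) powr e"
      by (simp add: field_simps)
    then have "harm (Suc n) * real (Suc n) powr (-x) \<le> (1 + 1 / e) * real (Suc n) powr e * real (Suc n) powr (-x)"
      by (intro mult_right_mono) auto
    also have "\<dots> = (1 + 1 / e) * real (Suc n) powr (e - x)"
      by (simp add: powr_diff powr_minus divide_inverse)
    finally show "norm (harm (Suc n) * real (Suc n) powr (-x)) \<le> (1 + 1 / e) * real (Suc n) powr (e - x)"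
      by (simp add: harm_nonneg abs_mult)
  qed
qed

text \<open>For \<open>t > 0\<close> this is the sum of \<open>H_n * exp (- n * t)\<close>, the
  generating function at \<open>x = exp (-t)\<close>.\<close>

definition harm_gf :: "real \<Rightarrow> real" where
  "harm_gf t = - ln (1 - exp (-t)) / (1 - exp (-t))"

lemma harm_gf_measurable [measurable]: "harm_gf \<in> borel_measurable borel"
  unfolding harm_gf_def by measurable

text \<open>Each term \<open>H_n * exp (- n * t)\<close> contributes
  \<open>Gamma s * H_n * n powr (-s)\<close>. The interchange of sum and integral is absolute,
  because the norms give the same integrals at the real exponent \<open>Re s > 1\<close>, where the
  Dirichlet series converges.\<close>

lemma harmonic_mellin:
  assumes s: "Re s > 1"
  shows "set_integrable lborel {0<..} (\<lambda>t. of_real t powr (s - 1) * of_real (harm_gf t))"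
    "(LINT t:{0<..}|lborel. of_real t powr (s - 1) * of_real (harm_gf t)) = Gamma s * harmonic_dirichlet_series s"
proof -
  define f where "f n t = complex_of_real (harm (Suc n)) * (of_real t powr (s - 1) / of_real (exp (real (Suc n) * t)))"
    for n t
  have norm_f: "norm (f n t) = harm (Suc n) * (t powr (Re s - 1) / exp (real (Suc n) * t))" if "t > 0" for n t
    using that by (simp add: f_def norm_mult norm_divide norm_powr_real_powr norm_harm del: of_nat_Suc of_real_harm)
  have exp_eq: "inverse (exp (real (Suc n) * t)) = exp (-t) ^ Suc n" for n t
    by (simp only: exp_of_nat_mult exp_minus power_inverse)
  have sums: "(\<lambda>n. f n t) sums (of_real t powr (s - 1) * of_real (harm_gf t))" if "t > 0" for t
  proof -
    have "(\<lambda>n. complex_of_real t powr (s - 1) * of_real (harm (Suc n) * exp (-t) ^ Suc n)) sums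
        (of_real t powr (s - 1) * of_real (harm_gf t))"
      unfolding harm_gf_def using sums_harm_power[of "exp (-t)"] that
      by (intro sums_mult sums_of_real) auto
    also have "(\<lambda>n. complex_of_real t powr (s - 1) * of_real (harm (Suc n) * exp (-t) ^ Suc n)) = (\<lambda>n. f n t)"
      unfolding f_def by (intro ext) (simp only: exp_eq [symmetric] of_real_mult divide_inverse of_real_inverse mult_ac)
    finally show ?thesis .
  qed
  have summ: "summable (\<lambda>n. norm (f n t))" if "t > 0" for t
  proof -
    have "summable (\<lambda>n. t powr (Re s - 1) * (harm (Suc n) * exp (-t) ^ Suc n))"
      using sums_harm_power[of "exp (-t)"] that by (intro summable_mult) (auto simp: sums_iff simp del: power_Suc)
    also have "(\<lambda>n. t powr (Re s - 1) * (harm (Suc n) * exp (-t) ^ Suc n)) = (\<lambda>n. norm (f n t))"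
      by (simp only: norm_f[OF that] divide_inverse exp_eq [symmetric] mult_ac)
    finally show ?thesis .
  qed
  have Res: "Re s > 0" "Re (complex_of_real (Re s)) > 0" using s by auto
  have int_f: "set_integrable lborel {0<..} (f n)" for n
    unfolding f_def using Gamma_set_integral(1)[OF Res(1), of "real (Suc n)"]
    by (intro set_integrable_mult_right) auto
  have "(LINT t:{0<..}|lborel. norm (f n t)) = Gamma (Re s) * (harm (Suc n) * real (Suc n) powr (-Re s))" for n
  proof -
    have "complex_of_real (LINT t:{0<..}|lborel. norm (f n t)) =
        (LINT t:{0<..}|lborel. complex_of_real (norm (f n t)))"
      by (rule set_integral_complex_of_real [symmetric])
    also have "\<dots> = (LINT t:{0<..}|lborel. complex_of_real (harm (Suc n)) *
        (of_real t powr (of_real (Re s) - 1) / of_real (exp (real (Suc n) * t))))"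
      by (intro set_lebesgue_integral_cong)
         (auto simp: norm_f powr_of_real [symmetric] simp del: of_nat_Suc of_real_harm)
    also have "\<dots> = of_real (harm (Suc n)) *
        (Gamma (of_real (Re s)) * of_real (real (Suc n)) powr (-of_real (Re s)))"
      by (subst set_integral_mult_right, subst Gamma_set_integral(2)[OF Res(2)]) (auto simp del: of_nat_Suc)
    also have "complex_of_real (real (Suc n)) powr (-of_real (Re s)) = of_real (real (Suc n) powr (- Re s))"
      by (simp add: powr_of_real [symmetric] del: of_nat_Suc)
    also have "of_real (harm (Suc n)) * (Gamma (of_real (Re s)) * \<dots>) =
        complex_of_real (Gamma (Re s) * (harm (Suc n) * real (Suc n) powr (-Re s)))"
      by (simp only: Gamma_complex_of_real of_real_mult mult_ac)
    finally show ?thesis by (simp only: of_real_eq_iff)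
  qed
  then have summ': "summable (\<lambda>n. LINT t:{0<..}|lborel. norm (f n t))"
    using summable_harm_powr[OF s] by (simp add: summable_mult del: of_nat_Suc)
  note * = set_integral_sums[where A = "{0<..}" and M = lborel and f = f, OF _ int_f _ summ']
  show "set_integrable lborel {0<..} (\<lambda>t. of_real t powr (s - 1) * of_real (harm_gf t))"
    by (rule *) (use summ sums in auto)
  have "(\<lambda>n. LINT t:{0<..}|lborel. f n t) sums (LINT t:{0<..}|lborel. of_real t powr (s - 1) * of_real (harm_gf t))"
    by (rule *) (use summ sums in auto)
  also have "(\<lambda>n. LINT t:{0<..}|lborel. f n t) = (\<lambda>n. Gamma s * (harm (Suc n) * of_nat (Suc n) powr (-s)))"
  proof
    fix n
    have "(LINT t:{0<..}|lborel. f n t) = of_real (harm (Suc n)) * (Gamma s * of_real (real (Suc n)) powr (-s))"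
      unfolding f_def using Gamma_set_integral[OF Res(1), of "real (Suc n)"]
      by (subst set_integral_mult_right) (auto simp del: of_nat_Suc)
    then show "(LINT t:{0<..}|lborel. f n t) = Gamma s * (harm (Suc n) * of_nat (Suc n) powr (-s))"
      by (simp only: of_real_harm of_real_of_nat_eq mult_ac)
  qed
  finally have **: "(\<lambda>n. Gamma s * (harm (Suc n) * of_nat (Suc n) powr (-s))) sums
     (LINT t:{0<..}|lborel. of_real t powr (s - 1) * of_real (harm_gf t))" .
  \<comment> \<open>Dividing by \<open>Gamma s\<close> shows that the Dirichlet series itself
    converges, so that its \<open>suminf\<close> is a genuine sum.\<close>
  have "Gamma s \<noteq> 0"
    using s by (auto simp: Gamma_eq_zero_iff elim!: nonpos_Ints_cases)
  with ** have "(\<lambda>n. harm (Suc n) * of_nat (Suc n) powr (-s)) sums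
     ((LINT t:{0<..}|lborel. of_real t powr (s - 1) * of_real (harm_gf t)) / Gamma s)"
    by (drule_tac sums_mult[where c = "inverse (Gamma s)"]) (auto simp: field_simps simp del: of_nat_Suc)
  with \<open>Gamma s \<noteq> 0\<close> show "(LINT t:{0<..}|lborel. of_real t powr (s - 1) * of_real (harm_gf t)) =
      Gamma s * harmonic_dirichlet_series s"
    by (simp add: harmonic_dirichlet_series_def sums_iff del: of_nat_Suc)
qed

section \<open>Mellin integrals over (0,1] and over t > 1\<close>

text \<open>The values come from explicit antiderivatives. Lebesgue integrability is proved first
  for the real exponent \<open>Re z\<close>, where the integrands have constant sign, and passes to
  complex \<open>z\<close> because the norms agree.\<close>

lemma powr_set_integral_0_1:
  fixes z :: complex
  assumes z: "Re z > 0"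
  shows "set_integrable lborel {0<..1} (\<lambda>t. of_real t powr (z - 1))"
    "(LINT t:{0<..1}|lborel. of_real t powr (z - 1)) = 1 / z"
    "set_integrable lborel {0<..1} (\<lambda>t. of_real t powr (z - 1) * of_real (ln t))"
    "(LINT t:{0<..1}|lborel. of_real t powr (z - 1) * of_real (ln t)) = - 1 / z ^ 2"
proof -
  \<comment> \<open>The fundamental theorem works on the closed interval; the endpoint 0 is a null
    set.\<close>
  have ae: "(f has_integral I) {0<..1}" if "(f has_integral I) {0..1}"
    for f :: "real \<Rightarrow> complex" and I
  proof -
    have "negligible {x \<in> {0..1} - {0<..1::real}. f x \<noteq> 0}"
      by (rule negligible_subset[of "{0}"]) auto
    moreover have "negligible {x \<in> {0<..1::real} - {0..1}. f x \<noteq> 0}"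
      by (rule negligible_subset[of "{0}"]) auto
    ultimately show ?thesis
      using has_integral_spike_set_eq[of "{0..1}" "{0<..1}" f I] that by blast
  qed
  have 1: "((\<lambda>t. of_real t powr (z - 1)) has_integral 1 / z) {0<..1}" if z: "Re z > 0" for z :: complex
  proof -
    have "((\<lambda>t. complex_of_real t powr (z - 1)) has_integral
            (of_real 1 powr z / z - of_real 0 powr z / z)) {0..1}" using z
      by (intro fundamental_theorem_of_calculus_interior)
         (auto intro!: continuous_intros derivative_eq_intros has_vector_derivative_real_field)
    then show ?thesis by (intro ae) auto
  qed
  \<comment> \<open>The antiderivative of the logarithmic integrand contains this product, so its
    continuity at 0 depends on this limit.\<close>
  have lim: "((\<lambda>t. complex_of_real t powr z * of_real (ln t)) \<longlongrightarrow> 0) (at_right 0)"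
    if "Re z > 0" for z
  proof -
    have "((\<lambda>t. t powr Re z * ln t) \<longlongrightarrow> 0) (at_right 0)"
      using that by real_asymp
    then have "((\<lambda>t. norm (complex_of_real t powr z * of_real (ln t))) \<longlongrightarrow> 0) (at_right 0)"
    proof (rule Lim_transform_eventually[OF tendsto_norm_zero])
      show "\<forall>\<^sub>F t in at_right 0. norm (t powr Re z * ln t) = norm (complex_of_real t powr z * of_real (ln t))"
        using eventually_at_right_less[of "0 :: real"]
        by eventually_elim (simp add: norm_mult norm_powr_real_powr abs_mult)
    qed
    then show ?thesis by (rule tendsto_norm_zero_cancel)
  qed
  have 2: "((\<lambda>t. of_real t powr (z - 1) * of_real (ln t)) has_integral - 1 / z ^ 2) {0<..1}"
    if z: "Re z > 0" for z :: complex
  proof -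
    \<comment> \<open>Antiderivative found by integration by parts. It vanishes at 0 and equals
      \<open>- 1 / z ^ 2\<close> at 1.\<close>
    define f where "f t = complex_of_real t powr z * of_real (ln t) / z - of_real t powr z / z ^ 2" for t
    have pw: "continuous_on {0..1} (\<lambda>t. complex_of_real t powr z)"
      using z by (auto intro!: continuous_intros)
    have "continuous (at x within {0..1}) f" if x: "x \<in> {0..1}" for x
    proof (cases "x = 0")
      case True
      have "((\<lambda>t. complex_of_real t powr z) \<longlongrightarrow> of_real 0 powr z) (at 0 within {0..1})"
        using bspec[OF pw[unfolded continuous_on_def], of 0] by simp
      moreover have "(at 0 within {0..1}) = at_right (0::real)"
        by (simp add: at_within_Icc_at_right)
      ultimately have "(f \<longlongrightarrow> 0 / z - 0 / z ^ 2) (at 0 within {0..1})"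
        unfolding f_def using z lim[OF z] by (intro tendsto_intros) auto
      then show ?thesis
        using True by (simp add: continuous_within f_def)
    next
      case False
      then have "isCont f x"
        using x z unfolding f_def by (auto intro!: continuous_intros)
      then show ?thesis
        by (rule continuous_at_imp_continuous_at_within)
    qed
    then have "continuous_on {0..1} f"
      by (simp add: continuous_on_eq_continuous_within)
    moreover have "(f has_vector_derivative (of_real t powr (z - 1) * of_real (ln t))) (at t)" if "t \<in> {0<..<1}" for t
    proof -
      \<comment> \<open>Differentiate in the complex variable, then restrict to the positive real
        axis, where \<open>Ln\<close> agrees with \<open>ln\<close>.\<close>
      have "((\<lambda>t. t powr z * Ln t / z - t powr z / z ^ 2) has_field_derivative
         (of_real t powr (z - 1) * Ln (of_real t))) (at (of_real t))"
        using that z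
        by (auto intro!: derivative_eq_intros simp: field_simps powr_diff power2_eq_square)
      then have "((\<lambda>t. of_real t powr z * Ln (of_real t) / z - of_real t powr z / z ^ 2) has_vector_derivative
         (of_real t powr (z - 1) * Ln (of_real t))) (at t)"
        by (rule has_vector_derivative_real_field)
      then have "((\<lambda>t. of_real t powr z * Ln (of_real t) / z - of_real t powr z / z ^ 2) has_vector_derivative
         (of_real t powr (z - 1) * of_real (ln t))) (at t)"
        using that by (simp add: Ln_of_real)
      then show ?thesis
        by (rule has_vector_derivative_transform_within_open[where S = "{0<..}"])
           (use that in \<open>auto simp: f_def Ln_of_real\<close>)
    qed
    ultimately have "((\<lambda>t. of_real t powr (z - 1) * of_real (ln t)) has_integral (f 1 - f 0)) {0..1}"
      by (intro fundamental_theorem_of_calculus_interior) auto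
    then show ?thesis using that by (intro ae) (auto simp: f_def)
  qed
  have pr: "complex_of_real t powr (of_real x - 1) = of_real (t powr (x - 1))" if "t > 0" for t x
    using that powr_of_real[of t "x - 1"] by simp
  have 3: "set_integrable lborel {0<..1} (\<lambda>t. t powr (Re z - 1))"
  proof (rule nonneg_has_integral_imp_set_lborel)
    have "((\<lambda>t. Re (of_real t powr (of_real (Re z) - 1))) has_integral Re (1 / of_real (Re z))) {0<..1}"
      using z by (intro has_integral_Re 1) auto
    then show "((\<lambda>t. t powr (Re z - 1)) has_integral Re (1 / of_real (Re z))) {0<..1}"
      by (rule has_integral_cong[THEN iffD1, rotated]) (auto simp: pr)
  qed auto
  \<comment> \<open>On (0,1] the logarithm is at most 0, so the minus sign makes the integrand
    nonnegative.\<close>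
  have 4: "set_integrable lborel {0<..1} (\<lambda>t. - (t powr (Re z - 1) * ln t))"
  proof (rule nonneg_has_integral_imp_set_lborel)
    have "((\<lambda>t. - Re (of_real t powr (of_real (Re z) - 1) * of_real (ln t))) has_integral - Re (- 1 / of_real (Re z) ^ 2)) {0<..1}"
      using z by (intro has_integral_neg has_integral_Re 2) auto
    then show "((\<lambda>t. - (t powr (Re z - 1) * ln t)) has_integral - Re (- 1 / of_real (Re z) ^ 2)) {0<..1}"
      by (rule has_integral_cong[THEN iffD1, rotated]) (auto simp: pr)
  qed (auto intro!: mult_nonneg_nonpos)
  show *: "set_integrable lborel {0<..1} (\<lambda>t. of_real t powr (z - 1))"
    by (rule set_integrable_bound[OF 3])
       (auto simp: norm_powr_real_powr set_borel_measurable_def)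
  show **: "set_integrable lborel {0<..1} (\<lambda>t. of_real t powr (z - 1) * of_real (ln t))"
    by (rule set_integrable_bound[OF 4])
       (auto simp: norm_powr_real_powr set_borel_measurable_def norm_mult abs_mult)
  show "(LINT t:{0<..1}|lborel. of_real t powr (z - 1)) = 1 / z"
    using set_borel_integral_eq_integral(2)[OF *] 1[OF z] by (simp add: integral_unique)
  show "(LINT t:{0<..1}|lborel. of_real t powr (z - 1) * of_real (ln t)) = - 1 / z ^ 2"
    using set_borel_integral_eq_integral(2)[OF **] 2[OF z] by (simp add: integral_unique)
qed

text \<open>The factor \<open>t ^ k\<close> shifts the exponent \<open>z\<close> to
  \<open>z + k\<close>, so each term is one of the integrals over (0,1] already evaluated. Since
  \<open>t \<le> 1\<close>, summability of the coefficients justifies integrating termwise.\<close>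

lemma power_series_mellin:
  fixes a :: "nat \<Rightarrow> real"
  assumes z: "Re z > 0" and a: "summable (\<lambda>k. \<bar>a k\<bar>)"
    and A: "\<And>t. 0 < t \<Longrightarrow> t \<le> 1 \<Longrightarrow> (\<lambda>k. a k * t ^ k) sums A t"
  shows "set_integrable lborel {0<..1} (\<lambda>t. of_real t powr (z - 1) * of_real (A t))" (is ?th1)
    "(\<lambda>k. of_real (a k) / (z + of_nat k)) sums (LINT t:{0<..1}|lborel. of_real t powr (z - 1) * of_real (A t))" (is ?th2)
    "set_integrable lborel {0<..1} (\<lambda>t. of_real t powr (z - 1) * of_real (ln t) * of_real (A t))" (is ?th3)
    "(\<lambda>k. of_real (a k) / (z + of_nat k) ^ 2) sums
       - (LINT t:{0<..1}|lborel. of_real t powr (z - 1) * of_real (ln t) * of_real (A t))" (is ?th4)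
proof -
  have sumb: "summable (\<lambda>k. norm (a k * t ^ k))" if "0 < t" "t \<le> 1" for t
    by (rule summable_comparison_test'[OF a, of 0])
       (use that in \<open>auto simp: abs_mult power_le_one intro!: mult_right_le_one_le\<close>)
  define f where "f = (\<lambda>k t. complex_of_real (a k) * of_real t powr (z + of_nat k - 1))"
  define g where "g = (\<lambda>k t. complex_of_real (a k) * (of_real t powr (z + of_nat k - 1) * of_real (ln t)))"
  have f_eq: "f k t = of_real t powr (z - 1) * of_real (a k * t ^ k)" if "t > 0" for k t
    using that by (simp add: f_def powr_add powr_diff powr_nat')
  have g_eq: "g k t = of_real t powr (z - 1) * of_real (ln t) * of_real (a k * t ^ k)" if "t > 0" for k t
    using that by (simp add: g_def powr_add powr_diff powr_nat')
  have Rek: "Re (z + of_nat k) > 0" "Re (complex_of_real (Re z + of_nat k)) > 0" for k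
    using z by (auto simp: add_pos_nonneg)
  \<comment> \<open>Writing the norms as real parts of the same integrands at the real exponent
    \<open>Re z + k\<close> lets the known values give the integrals of the norms as well.\<close>
  have nf: "norm (f k t) = \<bar>a k\<bar> * Re (of_real t powr (of_real (Re z + of_nat k) - 1))" if "t > 0" for k t
    using that powr_of_real[of t "Re z + real k - 1"] by (simp add: f_def norm_mult norm_powr_real_powr)
  have ng: "norm (g k t) = - \<bar>a k\<bar> * Re (of_real t powr (of_real (Re z + of_nat k) - 1) * of_real (ln t))"
    if "t > 0" "t \<le> 1" for k t
    using that powr_of_real[of t "Re z + real k - 1"] by (simp add: g_def norm_mult norm_powr_real_powr)
  have LRe: "(LINT t:A|lborel. Re (h t)) = Re (LINT t:A|lborel. h t)" if "set_integrable lborel A h"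
    for h :: "real \<Rightarrow> complex" and A
    using that integral_Re[of lborel "\<lambda>x. indicator A x *\<^sub>R h x"]
    by (simp add: set_lebesgue_integral_def set_integrable_def)
  have R: "Re (1 / complex_of_real x) = 1 / x" "Re (- 1 / complex_of_real x ^ 2) = - (1 / x ^ 2)" for x
    by (simp_all flip: of_real_power)
  have le: "\<bar>a k\<bar> / (Re z + real k) ^ p \<le> \<bar>a k\<bar> * (1 / Re z ^ p)" for k p
  proof -
    have "\<bar>a k\<bar> / (Re z + real k) ^ p \<le> \<bar>a k\<bar> / Re z ^ p"
      using z by (intro divide_left_mono power_mono mult_pos_pos) auto
    then show ?thesis by simp
  qed
  have "(LINT t:{0<..1}|lborel. norm (f k t)) = \<bar>a k\<bar> / (Re z + real k)" for k
  proof -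
    have "(LINT t:{0<..1}|lborel. norm (f k t)) =
        (LINT t:{0<..1}|lborel. \<bar>a k\<bar> * Re (of_real t powr (of_real (Re z + of_nat k) - 1)))"
      by (intro set_lebesgue_integral_cong) (auto simp: nf)
    also have "\<dots> = \<bar>a k\<bar> * Re (1 / of_real (Re z + of_nat k))"
      by (subst set_integral_mult_right, subst LRe)
         (use powr_set_integral_0_1[OF Rek(2)[of k]] in auto)
    finally show ?thesis unfolding R by simp
  qed
  moreover have "summable (\<lambda>k. \<bar>a k\<bar> / (Re z + real k))"
    by (rule summable_comparison_test'[OF summable_mult2[OF a, of "1 / Re z"], of 0])
       (use le[of _ 1] z in \<open>simp add: abs_divide\<close>)
  ultimately have f_sum: "summable (\<lambda>k. LINT t:{0<..1}|lborel. norm (f k t))" by simp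
  have "(LINT t:{0<..1}|lborel. norm (g k t)) = \<bar>a k\<bar> / (Re z + real k) ^ 2" for k
  proof -
    have "(LINT t:{0<..1}|lborel. norm (g k t)) =
        (LINT t:{0<..1}|lborel. - \<bar>a k\<bar> * Re (of_real t powr (of_real (Re z + of_nat k) - 1) * of_real (ln t)))"
      by (intro set_lebesgue_integral_cong) (auto simp: ng)
    also have "\<dots> = - \<bar>a k\<bar> * Re (-1 / of_real (Re z + of_nat k) ^ 2)"
      using powr_set_integral_0_1(4)[OF Rek(2)[of k]] LRe[OF powr_set_integral_0_1(3)[OF Rek(2)[of k]]]
      by (simp only: set_integral_mult_right)
    finally show ?thesis unfolding R by simp
  qed
  moreover have "summable (\<lambda>k. \<bar>a k\<bar> / (Re z + real k) ^ 2)"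
    by (rule summable_comparison_test'[OF summable_mult2[OF a, of "1 / Re z ^ 2"], of 0])
       (use le[of _ 2] z in \<open>simp add: abs_divide\<close>)
  ultimately have g_sum: "summable (\<lambda>k. LINT t:{0<..1}|lborel. norm (g k t))" by simp
  have f_int: "set_integrable lborel {0<..1} (f k)" for k
    unfolding f_def using powr_set_integral_0_1(1)[OF Rek(1)] by (intro set_integrable_mult_right) auto
  have g_int: "set_integrable lborel {0<..1} (g k)" for k
    unfolding g_def using powr_set_integral_0_1(3)[OF Rek(1)] by (intro set_integrable_mult_right) auto
  have f1: "summable (\<lambda>k. norm (f k t))" "(\<lambda>k. f k t) sums (of_real t powr (z - 1) * of_real (A t))"
    if "t \<in> {0<..1}" for t
    using that sumb[of t] A[of t] by (auto simp: f_eq norm_mult abs_mult simp del: of_real_mult intro!: summable_minus summable_mult sums_mult sums_of_real)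
  have g1: "summable (\<lambda>k. norm (g k t))" "(\<lambda>k. g k t) sums (of_real t powr (z - 1) * of_real (ln t) * of_real (A t))"
    if "t \<in> {0<..1}" for t
    using that sumb[of t] A[of t] by (auto simp: g_eq norm_mult abs_mult simp del: of_real_mult intro!: summable_minus summable_mult sums_mult sums_of_real)
  have M: "{0<..1::real} \<in> sets lborel" by simp
  note ff = set_integral_sums[OF M f_int f1(1) f_sum f1(2)]
  note gg = set_integral_sums[OF M g_int g1(1) g_sum g1(2)]
  show ?th1 ?th3 by (rule ff gg; assumption)+
  have "(LINT t:{0<..1}|lborel. f k t) = of_real (a k) / (z + of_nat k)" for k
    unfolding f_def by (subst set_integral_mult_right) (use powr_set_integral_0_1[OF Rek(1)] in auto)
  with ff(2) show ?th2 by simp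
  have "(LINT t:{0<..1}|lborel. g k t) = - (of_real (a k) / (z + of_nat k) ^ 2)" for k
    unfolding g_def by (subst set_integral_mult_right) (use powr_set_integral_0_1[OF Rek(1)] in auto)
  with sums_minus[OF gg(2)] show ?th4 by simp
qed

text \<open>Expanding \<open>t powr (s - 1) = exp ((s - 1) * ln t)\<close> in powers of
  \<open>s - 1\<close> and integrating termwise gives a power series about 1 that converges for
  every \<open>s\<close>.\<close>

lemma entire_mellin_tail:
  fixes F :: "real \<Rightarrow> real"
  assumes [measurable]: "F \<in> borel_measurable borel"
    and int: "\<And>x. x > 1 \<Longrightarrow> set_integrable lborel {1<..} (\<lambda>t. of_real t powr (of_real x - 1) * complex_of_real (F t))"
  shows "(\<lambda>s. LINT t:{1<..}|lborel. of_real t powr (s - 1) * complex_of_real (F t)) holomorphic_on UNIV"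
proof -
  define c where "c k = (LINT t:{1<..}|lborel. of_real (ln t) ^ k / fact k * complex_of_real (F t))" for k
  have "(\<lambda>k. c k * (s - 1) ^ k) sums (LINT t:{1<..}|lborel. of_real t powr (s - 1) * complex_of_real (F t))"
    for s :: complex
  proof -
    define f where "f = (\<lambda>k t. (of_real (ln t) ^ k / fact k * complex_of_real (F t)) * (s - 1) ^ k)"
    \<comment> \<open>The norms of the terms add up to
      \<open>t powr norm (s - 1) * \<bar>F t\<bar>\<close>. As \<open>t > 1\<close>, this is at most
      the integrand at the real exponent \<open>x - 1\<close>, and \<open>x > 1\<close> makes that
      integrable by assumption.\<close>
    define x where "x = norm (s - 1) + 2"
    have x: "x > 1" using norm_ge_zero[of "s - 1"] unfolding x_def by linarith
    have norm_f: "norm (f k t) = (ln t * norm (s - 1)) ^ k / fact k * \<bar>F t\<bar>" if "t > 1" for k t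
      using that by (simp add: f_def norm_mult norm_divide norm_power power_mult_distrib)
    have sums_norm: "(\<lambda>k. norm (f k t)) sums (exp (ln t * norm (s - 1)) * \<bar>F t\<bar>)" if "t > 1" for t
    proof -
      have "(\<lambda>k. (ln t * norm (s - 1)) ^ k / fact k * \<bar>F t\<bar>) sums (exp (ln t * norm (s - 1)) * \<bar>F t\<bar>)"
        using exp_converges[of "ln t * norm (s - 1)"] by (intro sums_mult2) (simp add: scaleR_conv_of_real divide_inverse mult_ac)
      then show ?thesis using that by (simp add: norm_f)
    qed
    have bound: "(\<Sum>k\<in>K. norm (f k t)) \<le> norm (of_real t powr (of_real x - 1) * complex_of_real (F t))"
      if "t > 1" "finite K" for K t
    proof -
      have "(\<Sum>k\<in>K. norm (f k t)) \<le> exp (ln t * norm (s - 1)) * \<bar>F t\<bar>"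
        using sums_norm[OF that(1)] that(2) by (metis norm_ge_zero sum_le_suminf sums_iff)
      also have "\<dots> \<le> exp (ln t * (x - 1)) * \<bar>F t\<bar>"
        using that by (intro mult_right_mono) (auto simp: x_def intro!: mult_left_mono)
      also have "\<dots> = norm (of_real t powr (of_real x - 1) * complex_of_real (F t))"
        using that by (simp add: norm_mult norm_powr_real_powr powr_def mult_ac)
      finally show ?thesis .
    qed
    note int' = int[OF x]
    have int_f: "set_integrable lborel {1<..} (f k)" for k
      by (rule set_integrable_bound[OF int'])
         (use bound[of _ "{k}"] in \<open>auto simp: set_borel_measurable_def f_def\<close>)
    have "summable (\<lambda>k. LINT t:{1<..}|lborel. norm (f k t))"
    proof (rule summableI_nonneg_bounded)
      show "0 \<le> (LINT t:{1<..}|lborel. norm (f k t))" for k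
        unfolding set_lebesgue_integral_def by (intro Bochner_Integration.integral_nonneg) auto
      fix n
      have "(\<Sum>k<n. LINT t:{1<..}|lborel. norm (f k t)) = (LINT t:{1<..}|lborel. (\<Sum>k<n. norm (f k t)))"
        unfolding set_lebesgue_integral_def using set_integrable_norm[OF int_f]
        by (subst Bochner_Integration.integral_sum [symmetric]) (auto simp: set_integrable_def sum_distrib_left)
      also have "\<dots> \<le> (LINT t:{1<..}|lborel. norm (of_real t powr (of_real x - 1) * complex_of_real (F t)))"
      proof (intro set_integral_mono)
        show "set_integrable lborel {1<..} (\<lambda>t. \<Sum>k<n. norm (f k t))"
          using set_integrable_norm[OF int_f] unfolding set_integrable_def scaleR_sum_right
          by (intro Bochner_Integration.integrable_sum)
      qed (use int' bound[of _ "{..<n}"] set_integrable_norm[OF int'] in auto)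
      finally show "(\<Sum>k<n. LINT t:{1<..}|lborel. norm (f k t)) \<le> \<dots>" .
    qed
    moreover have "(\<lambda>k. f k t) sums (of_real t powr (s - 1) * complex_of_real (F t))" if "t > 1" for t
    proof -
      have "(\<lambda>k. (of_real (ln t) * (s - 1)) ^ k /\<^sub>R fact k * complex_of_real (F t)) sums
          (exp (of_real (ln t) * (s - 1)) * of_real (F t))"
        by (intro sums_mult2 exp_converges)
      also have "exp (of_real (ln t) * (s - 1)) = of_real t powr (s - 1)"
        using that by (simp add: powr_def Ln_of_real mult_ac)
      also have "(\<lambda>k. (of_real (ln t) * (s - 1)) ^ k /\<^sub>R fact k * complex_of_real (F t)) = (\<lambda>k. f k t)"
        by (auto simp: f_def fun_eq_iff scaleR_conv_of_real power_mult_distrib divide_inverse mult_ac)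
      finally show ?thesis .
    qed
    moreover have "summable (\<lambda>k. norm (f k t))" if "t > 1" for t
      using sums_norm[OF that] by (rule sums_summable)
    ultimately have "(\<lambda>k. LINT t:{1<..}|lborel. f k t) sums
        (LINT t:{1<..}|lborel. of_real t powr (s - 1) * complex_of_real (F t))"
      by (intro set_integral_sums(2) int_f) simp_all
    then show ?thesis
      by (simp add: f_def c_def)
  qed
  then have "(\<lambda>s. LINT t:{1<..}|lborel. of_real t powr (s - 1) * complex_of_real (F t)) holomorphic_on ball 1 r" for r
    by (rule power_series_holomorphic)
  then have "(\<lambda>s. LINT t:{1<..}|lborel. of_real t powr (s - 1) * complex_of_real (F t)) holomorphic_on (\<Union>r. ball 1 r)"
    by (intro holomorphic_on_UN_open) auto
  also have "(\<Union>r. ball (1::complex) r) = UNIV"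
    using gt_ex by (auto simp: set_eq_iff)
  finally show ?thesis .
qed

section \<open>Partial fraction series with poles at 0, -1, -2, ..\<close>

text \<open>For \<open>Re z > 1 - N\<close> the denominators from index \<open>N\<close> on have
  norm at least 1, so the norms of \<open>c\<close> form a Weierstrass majorant.\<close>

lemma partial_fractions_tail_holomorphic:
  fixes c :: "nat \<Rightarrow> complex"
  assumes c: "summable (\<lambda>k. norm (c k))"
  shows "(\<lambda>z. \<Sum>k. c (k + N) / (z + of_nat (k + N)) ^ p) holomorphic_on {z. Re z > 1 - real N}"
    and "\<And>z. Re z > 1 - real N \<Longrightarrow> summable (\<lambda>k. c k / (z + of_nat k) ^ p)"
proof -
  have op: "open {z. Re z > 1 - real N}" by (simp add: open_halfspace_Re_gt)
  have ge1: "norm (z + of_nat (k + N)) \<ge> 1" if "Re z > 1 - real N" for z k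
    using complex_Re_le_cmod[of "z + of_nat (k + N)"] that by simp
  have le: "norm (c (k + N) / (z + of_nat (k + N)) ^ p) \<le> norm (c (k + N))" if "Re z > 1 - real N" for z k
  proof -
    have "norm (z + of_nat (k + N)) ^ p \<ge> 1"
      using ge1[OF that] by (rule one_le_power)
    then have "norm (c (k + N)) / norm (z + of_nat (k + N)) ^ p \<le> norm (c (k + N)) / 1"
      by (intro divide_left_mono) auto
    then show ?thesis by (simp only: norm_divide norm_power div_by_1)
  qed
  have c': "summable (\<lambda>k. norm (c (k + N)))"
    using c by (subst summable_iff_shift)
  show "(\<lambda>z. \<Sum>k. c (k + N) / (z + of_nat (k + N)) ^ p) holomorphic_on {z. Re z > 1 - real N}"
  proof (rule holomorphic_uniform_sequence[OF op])
    show "(\<lambda>z. \<Sum>k<n. c (k + N) / (z + of_nat (k + N)) ^ p) holomorphic_on {z. Re z > 1 - real N}" for n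
      using ge1 by (intro holomorphic_intros) (metis mem_Collect_eq norm_zero not_one_le_zero power_eq_0_iff)
    fix x assume x: "x \<in> {z. Re z > 1 - real N}"
    then obtain d where "d > 0" "cball x d \<subseteq> {z. Re z > 1 - real N}"
      using op open_contains_cball by blast
    moreover from this have "uniform_limit (cball x d) (\<lambda>n z. \<Sum>k<n. c (k + N) / (z + of_nat (k + N)) ^ p)
        (\<lambda>z. \<Sum>k. c (k + N) / (z + of_nat (k + N)) ^ p) sequentially"
      by (intro Weierstrass_m_test[OF _ c'] le) auto
    ultimately show "\<exists>d>0. cball x d \<subseteq> {z. 1 - real N < Re z} \<and>
        uniform_limit (cball x d) (\<lambda>n z. \<Sum>k<n. c (k + N) / (z + of_nat (k + N)) ^ p)
        (\<lambda>z. \<Sum>k. c (k + N) / (z + of_nat (k + N)) ^ p) sequentially"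
      by blast
  qed
  show "summable (\<lambda>k. c k / (z + of_nat k) ^ p)" if "Re z > 1 - real N" for z
    by (subst summable_iff_shift[of _ N, symmetric], rule summable_comparison_test'[OF c'], rule le[OF that])
qed

lemma partial_fractions_split:
  fixes c :: "nat \<Rightarrow> complex"
  assumes c: "summable (\<lambda>k. norm (c k))" and z: "Re z > 1 - real N"
  shows "(\<Sum>k. c k / (z + of_nat k) ^ p) =
    (\<Sum>k. c (k + N) / (z + of_nat (k + N)) ^ p) + (\<Sum>k<N. c k / (z + of_nat k) ^ p)"
  by (rule suminf_split_initial_segment) (rule partial_fractions_tail_holomorphic(2)[OF c z])

text \<open>On each half-plane \<open>Re z > 1 - N\<close> the series is a rational function plus a
  holomorphic tail, and these half-planes exhaust the plane.\<close>

lemma partial_fractions_meromorphic: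
  fixes c :: "nat \<Rightarrow> complex"
  assumes c: "summable (\<lambda>k. norm (c k))"
  shows "(\<lambda>z. \<Sum>k. c k / (z + of_nat k) ^ p) meromorphic_on UNIV"
proof -
  have "(\<lambda>z. \<Sum>k. c k / (z + of_nat k) ^ p) meromorphic_on {z. Re z > 1 - real N}" for N
  proof -
    have "(\<lambda>z. \<Sum>k. c (k + N) / (z + of_nat (k + N)) ^ p) meromorphic_on {z. Re z > 1 - real N}"
      using partial_fractions_tail_holomorphic(1)[OF c]
      by (intro analytic_on_imp_meromorphic_on) (simp add: analytic_on_open open_halfspace_Re_gt)
    then have "(\<lambda>z. (\<Sum>k. c (k + N) / (z + of_nat (k + N)) ^ p) + (\<Sum>k<N. c k / (z + of_nat k) ^ p))
       meromorphic_on {z. Re z > 1 - real N}"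
      by (intro meromorphic_intros) auto
    then show ?thesis
    proof (rule meromorphic_on_cong[THEN iffD1, rotated -1])
      fix z assume "z \<in> {z. Re z > 1 - real N}"
      then have "\<forall>\<^sub>F w in at z. w \<in> {z. Re z > 1 - real N}"
        by (intro eventually_at_in_open') (auto simp: open_halfspace_Re_gt)
      then show "\<forall>\<^sub>F w in at z. (\<Sum>k. c (k + N) / (w + of_nat (k + N)) ^ p) + (\<Sum>k<N. c k / (w + of_nat k) ^ p) =
          (\<Sum>k. c k / (w + of_nat k) ^ p)"
        by eventually_elim (simp add: partial_fractions_split[OF c] del: of_nat_add)
    qed simp
  qed
  then have "(\<lambda>z. \<Sum>k. c k / (z + of_nat k) ^ p) meromorphic_on (\<Union>N. {z. Re z > 1 - real N})"
    by (rule meromorphic_on_UN)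
  also have "(\<Union>N. {z. Re z > 1 - real N}) = UNIV"
  proof safe
    fix z :: complex
    obtain N where "real N > 1 - Re z" using reals_Archimedean2 by blast
    then have "Re z > 1 - real N" by simp
    then show "z \<in> (\<Union>N. {z. Re z > 1 - real N})" by blast
  qed auto
  finally show ?thesis .
qed

section \<open>Expansion of the generating function near t = 0\<close>

text \<open>Real parts of the Taylor coefficients represent the real part of \<open>f\<close> on the
  real axis. A radius above 1 makes the coefficients absolutely summable, as termwise integration up
  to \<open>t = 1\<close> demands.\<close>

lemma real_power_series_of_Re:
  fixes f :: "complex \<Rightarrow> complex"
  assumes f: "f holomorphic_on ball 0 r" and r: "r > 1"
    and F: "\<And>t. 0 < t \<Longrightarrow> t \<le> 1 \<Longrightarrow> Re (f (of_real t)) = F t"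
  obtains a :: "nat \<Rightarrow> real" where "summable (\<lambda>k. \<bar>a k\<bar>)"
    "\<And>t. 0 < t \<Longrightarrow> t \<le> 1 \<Longrightarrow> (\<lambda>k. a k * t ^ k) sums F t" "a 1 = Re (deriv f 0)"
proof
  define c where "c k = (deriv ^^ k) f 0 / fact k" for k
  have sums: "(\<lambda>k. c k * z ^ k) sums f z" if "z \<in> ball 0 r" for z
    using holomorphic_power_series[OF f that] by (simp add: c_def)
  \<comment> \<open>Convergence at a point \<open>x\<close> strictly between 1 and \<open>r\<close>
    implies absolute convergence at 1.\<close>
  define x where "x = (1 + r) / 2"
  have x: "x > 1" "x < r" using r by (auto simp: x_def)
  have "summable (\<lambda>k. norm (c k * 1 ^ k))"
    by (rule powser_insidea[where x = "of_real x"])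
       (use x sums[of "of_real x"] in \<open>auto simp: sums_iff\<close>)
  then have c: "summable (\<lambda>k. norm (c k))" by simp
  show "summable (\<lambda>k. \<bar>Re (c k)\<bar>)"
    by (rule summable_comparison_test'[OF c, of 0]) (auto simp: abs_Re_le_cmod)
  show "(\<lambda>k. Re (c k) * t ^ k) sums F t" if "0 < t" "t \<le> 1" for t
  proof -
    have "(\<lambda>k. Re (c k * of_real t ^ k)) sums Re (f (of_real t))"
      using that r by (intro sums_Re sums) auto
    then show ?thesis using F[OF that] by (simp flip: of_real_power)
  qed
  show "Re (c 1) = Re (deriv f 0)" by (simp add: c_def)
qed

text \<open>Dividing the exponential series by \<open>z\<close> leaves a power series that converges
  everywhere, with first coefficients 1 and -1/2.\<close>

lemma one_minus_exp_factorization: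
  obtains q :: "complex \<Rightarrow> complex" where "q holomorphic_on UNIV"
    "\<And>z. 1 - exp (-z) = z * q z" "q 0 = 1" "deriv q 0 = -1/2"
proof -
  define c :: "nat \<Rightarrow> complex" where "c n = (-1) ^ n / fact (Suc n)" for n
  have sums: "(\<lambda>n. c n * z ^ n) sums (if z = 0 then 1 else (1 - exp (-z)) / z)" for z
  proof (cases "z = 0")
    case True
    then show ?thesis using powser_sums_zero[of c] by (simp add: c_def)
  next
    case False
    have "(\<lambda>n. (-z) ^ n /\<^sub>R fact n) sums exp (-z)" by (rule exp_converges)
    then have "(\<lambda>n. (-z) ^ Suc n /\<^sub>R fact (Suc n)) sums (exp (-z) - 1)"
      by (subst sums_Suc_iff) simp
    then have "(\<lambda>n. ((-z) ^ Suc n /\<^sub>R fact (Suc n)) / (-z)) sums ((exp (-z) - 1) / (-z))"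
      by (rule sums_divide)
    also have "(\<lambda>n. ((-z) ^ Suc n /\<^sub>R fact (Suc n)) / (-z)) = (\<lambda>n. c n * z ^ n)"
    proof
      fix n
      have "(-z) ^ Suc n = -z * ((-1) ^ n * z ^ n)" by (subst power_Suc, subst power_minus) simp
      then show "((-z) ^ Suc n /\<^sub>R fact (Suc n)) / (-z) = c n * z ^ n"
        using False by (simp only: c_def scaleR_conv_of_real) (simp add: divide_inverse)
    qed
    also have "(exp (-z) - 1) / (-z) = (1 - exp (-z)) / z"
      by (simp add: divide_simps)
    finally show ?thesis using False by simp
  qed
  define q where "q z = (\<Sum>n. c n * z ^ n)" for z
  have q_eq: "q z = (if z = 0 then 1 else (1 - exp (-z)) / z)" for z
    using sums[of z] by (simp add: q_def sums_iff)
  have D: "(q has_field_derivative (\<Sum>n. diffs c n * z ^ n)) (at z)" for z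
    unfolding q_def by (rule termdiffs_strong_converges_everywhere) (use sums in \<open>auto simp: sums_iff\<close>)
  show ?thesis
  proof
    show "q holomorphic_on UNIV" using D by (auto simp: holomorphic_on_open)
    have "(\<Sum>n. diffs c n * 0 ^ n) = diffs c 0" by (rule powser_zero)
    then show "deriv q 0 = -1/2"
      using DERIV_imp_deriv[OF D[of 0]] by (simp add: diffs_def c_def)
  qed (auto simp: q_eq)
qed

text \<open>With \<open>q = exp g\<close> near 0, \<open>A\<close> is \<open>1 / q\<close> and
  \<open>B\<close> is \<open>g / q\<close> on the real axis; the term \<open>- ln t * A t\<close>
  isolates the logarithmic singularity of \<open>t * harm_gf t\<close>.\<close>

lemma harm_gf_expansion:
  obtains a b :: "nat \<Rightarrow> real" and A B :: "real \<Rightarrow> real" where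
    "summable (\<lambda>k. \<bar>a k\<bar>)" "summable (\<lambda>k. \<bar>b k\<bar>)"
    "\<And>t. 0 < t \<Longrightarrow> t \<le> 1 \<Longrightarrow> (\<lambda>k. a k * t ^ k) sums A t"
    "\<And>t. 0 < t \<Longrightarrow> t \<le> 1 \<Longrightarrow> (\<lambda>k. b k * t ^ k) sums B t"
    "\<And>t. 0 < t \<Longrightarrow> t \<le> 1 \<Longrightarrow> t * harm_gf t = - ln t * A t - B t"
    "a 1 = 1 / 2" "b 1 = - 1 / 2"
proof -
  obtain q where q: "q holomorphic_on UNIV" "\<And>z. 1 - exp (-z) = z * q z" "q 0 = 1" "deriv q 0 = -1/2"
    using one_minus_exp_factorization by metis
  \<comment> \<open>The zeros of \<open>1 - exp (-z)\<close> are the multiples of 2 pi i. The radius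
    6 lies below 2 pi, so \<open>q\<close> has no zero in this ball, and it exceeds 1.\<close>
  have hol_q: "q holomorphic_on ball 0 6" using q(1) by (rule holomorphic_on_subset) auto
  have nz: "q z \<noteq> 0" if "z \<in> ball 0 6" for z
  proof
    assume "q z = 0"
    then have "exp (-z) = 1" using q(2)[of z] by simp
    then obtain n :: int where n: "Re z = 0" "- Im z = of_int (2 * n) * pi" by (auto simp: exp_eq_1)
    have "\<bar>Im z\<bar> < 6" using that abs_Im_le_cmod[of z] by simp
    also have "\<bar>Im z\<bar> = \<bar>of_int n\<bar> * (2 * pi)"
      by (subst abs_minus_cancel [symmetric], subst n(2)) (simp add: abs_mult)
    finally have "\<bar>of_int n\<bar> * (2 * pi) < 6" .
    moreover have "\<bar>real_of_int n\<bar> * (2 * pi) \<ge> 1 * 6" if "n \<noteq> 0"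
      using that pi_gt3 by (intro mult_mono) auto
    ultimately have "n = 0" by fastforce
    then have "z = 0" using n by (simp add: complex_eq_iff)
    then show False using \<open>q z = 0\<close> q(3) by simp
  qed
  obtain g0 where g0: "g0 holomorphic_on ball 0 6" "\<And>z. z \<in> ball 0 6 \<Longrightarrow> q z = exp (g0 z)"
    using contractible_imp_holomorphic_log[OF hol_q _ nz] convex_imp_contractible[OF convex_ball] by metis
  \<comment> \<open>Since \<open>q 0 = 1\<close>, the value \<open>g0 0\<close> is a multiple of 2
    pi i; subtracting it gives the logarithm that vanishes at 0.\<close>
  define g where "g z = g0 z - g0 0" for z
  have hol_g: "g holomorphic_on ball 0 6"
    unfolding g_def by (intro holomorphic_intros g0)
  have g: "q z = exp (g z)" if "z \<in> ball 0 6" for z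
    using g0(2)[of 0] g0(2)[OF that] q(3) by (simp add: g_def exp_diff)
  have g_0: "g 0 = 0" by (simp add: g_def)
  have "(g has_field_derivative deriv g 0) (at 0)"
    using hol_g by (intro holomorphic_derivI) auto
  then have "((\<lambda>z. exp (g z)) has_field_derivative deriv g 0) (at 0)"
    by (auto intro!: derivative_eq_intros simp: g_0)
  then have "(q has_field_derivative deriv g 0) (at 0)"
    by (rule DERIV_cong_ev[THEN iffD1, OF refl _ refl, rotated])
       (auto intro!: eventually_mono[OF eventually_nhds_in_open[of "ball 0 6" 0]] simp: g)
  then have "deriv q 0 = deriv g 0" by (rule DERIV_imp_deriv)
  then have dg: "deriv g 0 = -1/2" using q(4) by simp
  have Dg: "(g has_field_derivative -1/2) (at 0)"
    using hol_g dg holomorphic_derivI[of g "ball 0 6" 0 UNIV] by auto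

  have pos: "1 - exp (-t) > 0" if "t > 0" for t :: real using that by simp
  have qt: "q (of_real t) = of_real ((1 - exp (-t)) / t)" if "t > 0" for t :: real
    using q(2)[of "of_real t"] that by (simp add: field_simps exp_of_real flip: of_real_minus)
  \<comment> \<open>The real part of any logarithm of \<open>q\<close> is the real logarithm of
    \<open>norm q\<close>, so no branch of \<open>g\<close> has to be identified.\<close>
  have Reg: "Re (g (of_real t)) = ln (1 - exp (-t)) - ln t" if "0 < t" "t \<le> 1" for t
  proof -
    have "exp (Re (g (of_real t))) = norm (q (of_real t))"
      using g[of "of_real t"] that by simp
    also have "\<dots> = (1 - exp (-t)) / t" using that by (simp only: qt norm_of_real) simp
    finally have "Re (g (of_real t)) = ln ((1 - exp (-t)) / t)" by (metis ln_exp)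
    also have "\<dots> = ln (1 - exp (-t)) - ln t" using that pos[of t] by (simp add: ln_div)
    finally show ?thesis .
  qed
  define A where "A t = t / (1 - exp (-t))" for t :: real
  define B where "B t = (ln (1 - exp (-t)) - ln t) * A t" for t :: real
  have eg: "exp (- g (of_real t)) = of_real (A t)" if "0 < t" "t \<le> 1" for t
  proof -
    have "exp (- g (of_real t)) = inverse (q (of_real t))"
      using g[of "of_real t"] that by (simp add: exp_minus)
    also have "\<dots> = of_real (inverse ((1 - exp (-t)) / t))"
      by (simp only: qt[OF that(1)] of_real_inverse)
    finally show ?thesis by (simp only: A_def inverse_divide)
  qed
  have "(\<lambda>z. exp (- g z)) holomorphic_on ball 0 6"
    by (intro holomorphic_intros hol_g)
  then obtain a where a: "summable (\<lambda>k. \<bar>a k\<bar>)"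
    "\<And>t. 0 < t \<Longrightarrow> t \<le> 1 \<Longrightarrow> (\<lambda>k. a k * t ^ k) sums A t" "a 1 = Re (deriv (\<lambda>z. exp (- g z)) 0)"
    by (rule real_power_series_of_Re[where F = A]) (auto simp: eg)
  have "(\<lambda>z. g z * exp (- g z)) holomorphic_on ball 0 6"
    by (intro holomorphic_intros hol_g)
  then obtain b where b: "summable (\<lambda>k. \<bar>b k\<bar>)"
    "\<And>t. 0 < t \<Longrightarrow> t \<le> 1 \<Longrightarrow> (\<lambda>k. b k * t ^ k) sums B t" "b 1 = Re (deriv (\<lambda>z. g z * exp (- g z)) 0)"
    by (rule real_power_series_of_Re[where F = B]) (auto simp: eg B_def Reg)
  \<comment> \<open>As \<open>g 0 = 0\<close>, the derivatives of \<open>exp (- g)\<close> and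
    \<open>g * exp (- g)\<close> at 0 are \<open>- deriv g 0\<close> and
    \<open>deriv g 0\<close>.\<close>
  have "((\<lambda>z. exp (- g z)) has_field_derivative 1/2) (at 0)"
    by (rule derivative_eq_intros Dg refl)+ (simp add: g_0)
  then have a1: "a 1 = 1 / 2" using a(3) by (simp add: DERIV_imp_deriv)
  have "((\<lambda>z. g z * exp (- g z)) has_field_derivative -1/2) (at 0)"
    by (rule derivative_eq_intros Dg refl)+ (simp add: g_0)
  then have b1: "b 1 = - 1 / 2" using b(3) by (simp add: DERIV_imp_deriv)
  have "t * harm_gf t = - ln t * A t - B t" if "0 < t" "t \<le> 1" for t
    by (simp add: harm_gf_def A_def B_def algebra_simps diff_divide_distrib)
  then show ?thesis using that a(1,2) b(1,2) a1 b1 by blast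
qed

section \<open>Uniqueness of the meromorphic continuation\<close>

text \<open>Both sides are 0 at a pole and the limit of \<open>f\<close> at any other point. Values
  are therefore determined by punctured neighborhoods.\<close>

lemma nicely_meromorphic_eq_remove_sings:
  assumes "f nicely_meromorphic_on A" "z \<in> A"
  shows "f z = remove_sings f z"
  using assms remove_sings_eqI[of f "f z" z] by (auto simp: nicely_meromorphic_on_def)

text \<open>Identity theorem: on a connected open set the difference vanishes, or is nonzero, off a
  sparse set, and agreement near \<open>z0\<close> rules out the latter.\<close>

lemma nicely_meromorphic_unique:
  assumes f: "f nicely_meromorphic_on A" and g: "g nicely_meromorphic_on A"
    and A: "open A" "connected A" and z0: "z0 \<in> A" and eq: "eventually (\<lambda>z. f z = g z) (at z0)"
    and z: "z \<in> A"
  shows "f z = g z"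
proof -
  have "(\<lambda>z. f z - g z) meromorphic_on A"
    using f g by (intro meromorphic_intros) (auto simp: nicely_meromorphic_on_def)
  then consider "eventually (\<lambda>z. f z - g z = 0) (cosparse A)" | "eventually (\<lambda>z. f z - g z \<noteq> 0) (cosparse A)"
    using meromorphic_imp_constant_or_avoid[OF _ A] by blast
  then have "eventually (\<lambda>z. f z - g z = 0) (cosparse A)"
  proof cases
    case 2
    then have "eventually (\<lambda>z. f z - g z \<noteq> 0) (at z0)"
      using z0 by (rule eventually_cosparse_imp_eventually_at)
    with eq have "eventually (\<lambda>z. False) (at z0)"
      by eventually_elim auto
    then show ?thesis by (simp add: eventually_False)
  qed
  then have "eventually (\<lambda>z. f z - g z = 0) (at z)"
    using z by (rule eventually_cosparse_imp_eventually_at)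
  then have "remove_sings f z = remove_sings g z"
    by (intro remove_sings_cong) (auto elim: eventually_mono)
  then show ?thesis
    using nicely_meromorphic_eq_remove_sings f g z by metis
qed

text \<open>Resolves the definite description: \<open>remove_sings H\<close> is a witness, and
  uniqueness follows from agreement near 2, a point of the half-plane of convergence. Analyticity of
  \<open>H\<close> there ensures that \<open>remove_sings\<close> keeps its values.\<close>

lemma harmonic_zeta_eqI:
  assumes H: "H meromorphic_on UNIV" "H analytic_on {s. Re s > 1}"
    and eq: "\<And>s. Re s > 1 \<Longrightarrow> H s = harmonic_dirichlet_series s"
  shows "harmonic_zeta = remove_sings H"
  unfolding harmonic_zeta_def
proof (rule the_equality)
  have 1: "remove_sings H s = harmonic_dirichlet_series s" if "Re s > 1" for s
    using eq[OF that] analytic_on_subset[OF H(2), of "{s}"] that by simp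
  then show *: "remove_sings H nicely_meromorphic_on UNIV \<and>
      (\<forall>s. Re s > 1 \<longrightarrow> remove_sings H s = harmonic_dirichlet_series s)"
    using remove_sings_nicely_meromorphic[OF H(1)] by blast
  fix f assume f: "f nicely_meromorphic_on UNIV \<and> (\<forall>s. Re s > 1 \<longrightarrow> f s = harmonic_dirichlet_series s)"
  have "eventually (\<lambda>s. s \<in> {s. Re s > 1}) (at (2 :: complex))"
    by (intro eventually_at_in_open') (auto simp: open_halfspace_Re_gt)
  then have "eventually (\<lambda>s. f s = remove_sings H s) (at 2)"
    by eventually_elim (use f 1 in auto)
  then show "f = remove_sings H"
    using nicely_meromorphic_unique[of f UNIV "remove_sings H" 2] f * by auto
qed

section \<open>The Laurent expansion at s = 0\<close>

text \<open>The difference quotient of \<open>f\<close> at 0 extends to a holomorphic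
  \<open>g\<close>, and the left-hand function is \<open>g s - g 0\<close>, which is O(s).\<close>

lemma first_order_taylor_bigo:
  fixes f :: "complex \<Rightarrow> complex"
  assumes f: "f holomorphic_on S" "open S" "0 \<in> S" and D: "(f has_field_derivative D) (at 0)"
  shows "(\<lambda>s. (f s - f 0 - D * s) / s) \<in> O[at 0](\<lambda>s. s)"
proof (rule bigoI_tendsto)
  define g where "g = (\<lambda>z. if z = 0 then deriv f 0 else (f z - f 0) / (z - 0))"
  have "g holomorphic_on S"
    unfolding g_def by (rule pole_lemma_open) fact+
  then have "(g has_field_derivative deriv g 0) (at 0)"
    using f by (intro holomorphic_derivI) auto
  then have "((\<lambda>s. (g s - g 0) / (s - 0)) \<longlongrightarrow> deriv g 0) (at 0)"
    by (simp add: has_field_derivative_iff)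
  then show "((\<lambda>s. (f s - f 0 - D * s) / s / s) \<longlongrightarrow> deriv g 0) (at 0)"
    by (rule Lim_transform_eventually)
       (auto simp: eventually_at_filter g_def DERIV_imp_deriv[OF D] diff_divide_distrib intro!: always_eventually)
  show "eventually (\<lambda>s::complex. s \<noteq> 0) (at 0)"
    by (rule eventually_neq_at_within)
qed

theorem corollary2:
  "(\<lambda>s. harmonic_zeta s - (1 / (2 * s) + 1 / 2 * (1 + euler_mascheroni))) \<in> O[at 0](\<lambda>s. s)"
proof -
  obtain a b :: "nat \<Rightarrow> real" and A B :: "real \<Rightarrow> real" where
    a: "summable (\<lambda>k. \<bar>a k\<bar>)" and b: "summable (\<lambda>k. \<bar>b k\<bar>)"
    and A: "\<And>t. 0 < t \<Longrightarrow> t \<le> 1 \<Longrightarrow> (\<lambda>k. a k * t ^ k) sums A t"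
    and B: "\<And>t. 0 < t \<Longrightarrow> t \<le> 1 \<Longrightarrow> (\<lambda>k. b k * t ^ k) sums B t"
    and AB: "\<And>t. 0 < t \<Longrightarrow> t \<le> 1 \<Longrightarrow> t * harm_gf t = - ln t * A t - B t"
    and ab1: "a 1 = 1 / 2" "b 1 = - 1 / 2"
    by (rule harm_gf_expansion) blast
  define a' b' where "a' k = complex_of_real (a k)" and "b' k = complex_of_real (b k)" for k
  have a': "summable (\<lambda>k. norm (a' k))" and b': "summable (\<lambda>k. norm (b' k))"
    using a b by (simp_all add: a'_def b'_def)
  \<comment> \<open>The expansion is of \<open>t * harm_gf t\<close>, which lowers the exponent of
    \<open>t\<close> by one; hence \<open>P\<close> and \<open>Q\<close> are evaluated at
    \<open>s - 1\<close>. The power \<open>^ 1\<close> in \<open>Q\<close> matches the common form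
    of the partial fraction lemmas.\<close>
  define P where "P = (\<lambda>z. \<Sum>k. a' k / (z + of_nat k) ^ 2)"
  define Q where "Q = (\<lambda>z. \<Sum>k. b' k / (z + of_nat k) ^ 1)"
  define E where "E = (\<lambda>s. LINT t:{1<..}|lborel. of_real t powr (s - 1) * complex_of_real (harm_gf t))"
  \<comment> \<open>Multiplying by the entire function \<open>rGamma\<close> amounts to dividing the
    Mellin transform by \<open>Gamma s\<close>.\<close>
  define H where "H s = rGamma s * (P (s - 1) - Q (s - 1) + E s)" for s

  have int1: "set_integrable lborel {1<..} (\<lambda>t. of_real t powr (s - 1) * complex_of_real (harm_gf t))"
    if "Re s > 1" for s
    by (rule set_integrable_subset[OF harmonic_mellin(1)[OF that]]) auto
  have E_hol: "E holomorphic_on X" for X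
    unfolding E_def using int1
    by (intro holomorphic_on_subset[OF entire_mellin_tail]) auto

  have H_eq: "H s = harmonic_dirichlet_series s" if s: "Re s > 1" for s
  proof -
    have z: "Re (s - 1) > 0" using s by simp
    let ?L = "\<lambda>t. of_real t powr (s - 1 - 1) * of_real (ln t) * complex_of_real (A t)"
    let ?M = "\<lambda>t. of_real t powr (s - 1 - 1) * complex_of_real (B t)"
    have L: "set_integrable lborel {0<..1} ?L" "P (s - 1) = - (LINT t:{0<..1}|lborel. ?L t)"
      using power_series_mellin(3,4)[OF z a A] by (simp_all add: P_def a'_def sums_iff)
    have M: "set_integrable lborel {0<..1} ?M" "Q (s - 1) = (LINT t:{0<..1}|lborel. ?M t)"
      using power_series_mellin(1,2)[OF z b B] by (simp_all add: Q_def b'_def sums_iff)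
    have int0: "set_integrable lborel {0<..1} (\<lambda>t. of_real t powr (s - 1) * complex_of_real (harm_gf t))"
      by (rule set_integrable_subset[OF harmonic_mellin(1)[OF s]]) auto
    have "(LINT t:{0<..1}|lborel. of_real t powr (s - 1) * complex_of_real (harm_gf t)) =
        (LINT t:{0<..1}|lborel. - ?L t - ?M t)"
    proof (intro set_lebesgue_integral_cong allI impI)
      fix t :: real assume t: "t \<in> {0<..1}"
      have "of_real t powr (s - 1) * complex_of_real (harm_gf t) =
          of_real t powr (s - 1 - 1) * of_real (t * harm_gf t)"
        using t by (subst (2) powr_diff) auto
      also have "\<dots> = - ?L t - ?M t"
        using t by (subst AB) (auto simp: algebra_simps)
      finally show "of_real t powr (s - 1) * complex_of_real (harm_gf t) = - ?L t - ?M t" .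
    qed auto
    also have "\<dots> = P (s - 1) - Q (s - 1)"
      using L M by (subst set_integral_diff) (auto simp: set_integral_uminus set_integrable_def)
    finally have "P (s - 1) - Q (s - 1) + E s =
        (LINT t:{0<..1} \<union> {1<..}|lborel. of_real t powr (s - 1) * complex_of_real (harm_gf t))"
      unfolding E_def using int1[OF s] int0 by (subst set_integral_Un) auto
    also have "{0<..1} \<union> {1<..} = {0<..(1::real)} \<union> {1..}" by auto
    also have "\<dots> = {0<..}" by auto
    finally have "H s = rGamma s * (Gamma s * harmonic_dirichlet_series s)"
      using harmonic_mellin(2)[OF s] by (simp add: H_def)
    moreover have "Gamma s \<noteq> 0"
      using s by (auto simp: Gamma_eq_zero_iff elim!: nonpos_Ints_cases)
    ultimately show ?thesis
      by (simp add: rGamma_inverse_Gamma)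
  qed

  have H_mero: "H meromorphic_on UNIV"
  proof -
    have shift: "(\<lambda>s. s - 1 :: complex) analytic_on UNIV" by (intro analytic_intros)
    have "(\<lambda>s. P (s - 1)) meromorphic_on UNIV" "(\<lambda>s. Q (s - 1)) meromorphic_on UNIV"
      unfolding P_def Q_def
      by (rule meromorphic_on_compose[OF partial_fractions_meromorphic[OF a'] shift]
               meromorphic_on_compose[OF partial_fractions_meromorphic[OF b'] shift], simp)+
    moreover have "rGamma meromorphic_on UNIV" "E meromorphic_on UNIV"
      using E_hol by (auto intro!: analytic_on_imp_meromorphic_on simp: analytic_on_open holomorphic_rGamma)
    ultimately show ?thesis
      unfolding H_def by (intro meromorphic_intros)
  qed

  define T where "T c N p s = (\<Sum>k. c (k + N) / ((s - 1) + of_nat (k + N)) ^ p)"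
    for c :: "nat \<Rightarrow> complex" and N p and s :: complex
  have split: "P (s - 1) = T a' N 2 s + (\<Sum>k<N. a' k / ((s - 1) + of_nat k) ^ 2)"
     "Q (s - 1) = T b' N 1 s + (\<Sum>k<N. b' k / ((s - 1) + of_nat k) ^ 1)"
    if "Re s > 2 - real N" for s N
    unfolding P_def Q_def T_def using that
    by (intro partial_fractions_split a' b'; simp)+
  have T_hol: "T c N p holomorphic_on X"
    if "summable (\<lambda>k. norm (c k))" "\<And>s. s \<in> X \<Longrightarrow> Re s > 2 - real N" for c N p X
  proof -
    have "(\<lambda>s :: complex. s - 1) holomorphic_on X"
      by (intro holomorphic_intros)
    from holomorphic_on_compose_gen[OF this partial_fractions_tail_holomorphic(1)[OF that(1)], of N p]
    show ?thesis using that(2) by (simp add: T_def [abs_def] o_def image_subset_iff)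
  qed

  \<comment> \<open>Splitting off only the terms with \<open>k = 0\<close>, whose pole is at
    \<open>s = 1\<close>, suffices for \<open>Re s > 1\<close>.\<close>
  have "(\<lambda>s. rGamma s * ((T a' 1 2 s + a' 0 / (s - 1) ^ 2) - (T b' 1 1 s + b' 0 / (s - 1)) + E s))
      holomorphic_on {s. Re s > 1}"
    by (intro holomorphic_intros E_hol T_hol a' b') auto
  then have "H holomorphic_on {s. Re s > 1}"
    by (rule holomorphic_transform) (simp add: H_def split[of 1])
  then have "H analytic_on {s. Re s > 1}"
    by (simp add: analytic_on_open open_halfspace_Re_gt)
  with H_mero H_eq have zeta: "harmonic_zeta = remove_sings H"
    by (intro harmonic_zeta_eqI)
  then have zeta_H: "eventually (\<lambda>s. harmonic_zeta s = H s) (at 0)"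
    unfolding zeta using H_mero
    by (intro eventually_remove_sings_eq_at meromorphic_on_isolated_singularity)
       (rule meromorphic_on_subset, auto)

  \<comment> \<open>With \<open>N = 3\<close> the tails are holomorphic for
    \<open>Re s > -1\<close>, which covers the unit ball. \<open>U\<close> collects everything
    except the terms with \<open>k = 1\<close>, whose denominators are powers of \<open>s\<close>
    and which alone produce the pole at 0.\<close>
  define U where "U s = T a' 3 2 s + a' 0 / (s - 1) ^ 2 + a' 2 / (s + 1) ^ 2
      - T b' 3 1 s - b' 0 / (s - 1) - b' 2 / (s + 1) + E s" for s
  \<comment> \<open>This is \<open>s * H s\<close>, by \<open>rGamma s = s * rGamma (s + 1)\<close>
    and the terms \<open>1 / (2 * s ^ 2) + 1 / (2 * s)\<close> coming from \<open>a 1\<close> and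
    \<open>b 1\<close>.\<close>
  define G where "G s = rGamma (s + 1) * (1 / 2 + s / 2 + s ^ 2 * U s)" for s
  have U_hol: "U holomorphic_on ball 0 1"
  proof -
    have "Re s > 2 - real 3" if "s \<in> ball 0 1" for s
      using abs_Re_le_cmod[of s] that by auto
    moreover have "s - 1 \<noteq> 0" "s + 1 \<noteq> 0" if "s \<in> ball 0 1" for s :: complex
      using that by (auto simp: add_eq_0_iff2)
    ultimately show ?thesis
      unfolding U_def
      by (intro holomorphic_intros E_hol T_hol a' b') auto
  qed
  have G_hol: "G holomorphic_on ball 0 1"
    unfolding G_def by (intro holomorphic_intros U_hol) auto
  have G_0: "G 0 = 1 / 2"
    by (simp add: G_def)
  have "(U has_field_derivative deriv U 0) (at 0)"
    using U_hol by (intro holomorphic_derivI) auto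
  \<comment> \<open>The derivative of \<open>rGamma\<close> at 1 is \<open>- Digamma 1\<close>, the
    Euler constant; the product rule adds 1/2 from the term \<open>s / 2\<close>.\<close>
  then have G_deriv: "(G has_field_derivative (1 + euler_mascheroni) / 2) (at 0)"
    unfolding G_def by (auto intro!: derivative_eq_intros simp: field_simps)
  have GH: "H s = G s / s" if "s \<in> ball 0 1 - {0}" for s
  proof -
    have "Re s > 2 - real 3" "s \<noteq> 0"
      using abs_Re_le_cmod[of s] that by auto
    moreover have "(\<Sum>k<3. f k) = f 0 + f 1 + f 2" for f :: "nat \<Rightarrow> complex"
      by (simp add: eval_nat_numeral)
    moreover have "s - 1 + of_nat 2 = s + 1" by simp
    moreover have "a' 1 = 1 / 2" "b' 1 = - 1 / 2" by (simp_all only: a'_def b'_def ab1) simp_all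
    ultimately have "P (s - 1) - Q (s - 1) + E s = 1 / (2 * s ^ 2) + 1 / (2 * s) + U s"
      by (simp only: split[of 3] U_def) simp
    moreover have "rGamma s = s * rGamma (s + 1)" by (simp add: rGamma_plus1)
    ultimately have "H s = s * rGamma (s + 1) * (1 / (2 * s ^ 2) + 1 / (2 * s) + U s)"
      by (simp only: H_def)
    also have "\<dots> = rGamma (s + 1) * (s * (1 / (2 * s ^ 2) + 1 / (2 * s) + U s))"
      by (simp only: mult_ac)
    also have "s * (1 / (2 * s ^ 2) + 1 / (2 * s) + U s) = (1 / 2 + s / 2 + s ^ 2 * U s) / s"
      using \<open>s \<noteq> 0\<close> by (simp add: field_simps power2_eq_square)
    finally show ?thesis by (simp add: G_def)
  qed
  have "eventually (\<lambda>s. s \<in> ball 0 1 - {0}) (at (0 :: complex))"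
    by (intro eventually_at_in_open) auto
  \<comment> \<open>Subtracting the claimed principal part and constant from \<open>G s / s\<close>
    leaves the first-order Taylor remainder of \<open>G\<close> divided by \<open>s\<close>.\<close>
  with zeta_H have "eventually (\<lambda>s. harmonic_zeta s - (1 / (2 * s) + 1 / 2 * (1 + euler_mascheroni)) =
      (G s - G 0 - (1 + euler_mascheroni) / 2 * s) / s) (at 0)"
  proof eventually_elim
    case (elim s)
    then show ?case by (simp add: GH G_0 field_simps)
  qed
  then show ?thesis
    using first_order_taylor_bigo[OF G_hol _ _ G_deriv] by (subst landau_o.big.in_cong) auto
qed

end
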